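(* Let $G$ be a graph with $n$ vertices, let $k\geq 1$ be an integer with $n\geq k+1$, and let $X$ be a set of vertices of the $k$-token graph $F_k(G)$. Then $X$ is a clique of $F_k(G)$ if and only if there is a clique $K$ of $G$ and a set $S\subseteq V(G)$ such that $K\cap S=\varnothing$ and either (a) $X=\{S\cup\{v\} : v\in K\}$ and $|S|=k-1$, or (b) $X=\{(S\cup K)\setminus\{v\} : v\in K\}$ and $|S|+|K|=k+1$.
   Context: Graphs are finite, simple and undirected. For a graph $G$ and an integer $k\geq 1$, the $k$-token graph $F_k(G)$ is the graph whose vertices are the $k$-element subsets of $V(G)$, where two vertices $A,B$ are adjacent whenever their symmetric difference $A\triangle B$ is a pair $\{a,b\}$ with $a\in A$, $b\in B$ and $ab\in E(G)$. A clique in a graph is a set of pairwise adjacent vertices (not necessarily maximal). *)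

theory Defs
  imports "Graph_Theory.Pair_Digraph" "HOL-Library.Ramsey"
begin

text \<open>Finite simple undirected graphs are the \<open>pair_graph\<close>s of the library: finite vertex set,
  symmetric arc relation, no loops. An edge \<open>uv\<close> is the pair of arcs \<open>(u,v)\<close>, \<open>(v,u)\<close>.\<close>

definition token_graph :: "nat \<Rightarrow> 'a pair_pre_digraph \<Rightarrow> 'a set pair_pre_digraph" where
  "token_graph k G =
    \<lparr> pverts = [pverts G]\<^bsup>k\<^esup>,
      parcs = {(A, B). A \<in> [pverts G]\<^bsup>k\<^esup> \<and> B \<in> [pverts G]\<^bsup>k\<^esup> \<and>
                 (\<exists>a\<in>A. \<exists>b\<in>B. sym_diff A B = {a, b} \<and> (a, b) \<in> parcs G)} \<rparr>"

text \<open>Cliques need not be maximal; the empty set and singletons are cliques.\<close>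

definition is_clique :: "'a pair_pre_digraph \<Rightarrow> 'a set \<Rightarrow> bool" where
  "is_clique G K \<longleftrightarrow> K \<subseteq> pverts G \<and> (\<forall>u\<in>K. \<forall>v\<in>K. u \<noteq> v \<longrightarrow> (u, v) \<in> parcs G)"

lemma verts_token_graph [simp]: "pverts (token_graph k G) = [pverts G]\<^bsup>k\<^esup>"
  by (simp add: token_graph_def)

lemma arcs_token_graph_iff:
  "(A, B) \<in> parcs (token_graph k G) \<longleftrightarrow>
    A \<in> [pverts G]\<^bsup>k\<^esup> \<and> B \<in> [pverts G]\<^bsup>k\<^esup> \<and>
    (\<exists>a\<in>A. \<exists>b\<in>B. sym_diff A B = {a, b} \<and> (a, b) \<in> parcs G)"
  by (simp add: token_graph_def)

lemma pair_graph_token_graph: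
  assumes "pair_graph G"
  shows "pair_graph (token_graph k G)"
proof -
  interpret G: pair_graph G by fact
  let ?F = "token_graph k G"
  have in_verts: "A \<in> pverts ?F" "B \<in> pverts ?F" if "(A, B) \<in> parcs ?F" for A B
    using that unfolding arcs_token_graph_iff verts_token_graph by blast+
  have fin: "finite (pverts ?F)"
    unfolding verts_token_graph by (rule finite_imp_finite_nsets) (rule G.pair_finite_verts)
  have fin_arcs: "finite (parcs ?F)"
  proof (rule finite_subset)
    show "parcs ?F \<subseteq> pverts ?F \<times> pverts ?F"
      using in_verts by (intro subrelI SigmaI)
    show "finite (pverts ?F \<times> pverts ?F)"
      using fin fin by (rule finite_cartesian_product)
  qed
  have sym: "(B, A) \<in> parcs ?F" if AB: "(A, B) \<in> parcs ?F" for A B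
  proof -
    from AB obtain a b where ab: "a \<in> A" "b \<in> B" "sym_diff A B = {a, b}" "(a, b) \<in> parcs G"
      unfolding arcs_token_graph_iff by blast
    have "(b, a) \<in> parcs G"
      using G.pair_sym_arcs ab(4) unfolding symmetric_def with_proj_simps by (rule symD)
    moreover have "sym_diff B A = {b, a}"
      using ab(3) by (simp only: Un_commute insert_commute)
    ultimately show ?thesis
      using in_verts[OF AB] ab(1,2) unfolding arcs_token_graph_iff verts_token_graph
      by (intro conjI bexI[of _ b] bexI[of _ a])
  qed
  have no_loop: "A \<noteq> B" if "(A, B) \<in> parcs ?F" for A B
  proof
    assume "A = B"
    with that show False
      unfolding arcs_token_graph_iff by simp
  qed
  show ?thesis
  proof unfold_locales
    show "symmetric (with_proj ?F)"
      unfolding symmetric_def with_proj_simps using sym by (rule symI)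
    show "fst e \<in> pverts ?F" "snd e \<in> pverts ?F" "fst e \<noteq> snd e" if "e \<in> parcs ?F" for e
      using that in_verts[of "fst e" "snd e"] no_loop[of "fst e" "snd e"]
      unfolding prod.collapse by blast+
  qed (fact fin fin_arcs)+
qed

end

theory Submission
  imports Defs
begin

text \<open>Adjacent vertices of the token graph are sets \<open>insert a I\<close> and \<open>insert b I\<close>, with
  intersection \<open>I\<close> and union \<open>U = insert a (insert b I)\<close>. A set adjacent to both either
  contains \<open>I\<close> or is contained in \<open>U\<close>.
  A set of the form \<open>insert c I\<close> with \<open>c \<notin> U\<close> and one of the form \<open>U - {d}\<close> with \<open>d \<in> I\<close> differ
  by at least four elements, so in a clique only one of the two kinds occurs.\<close>

text \<open>On the \<open>k\<close>-subsets of a finite set this is adjacency in the Johnson graph,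
  the token graph of a complete graph. The edges of \<open>G\<close> enter only later.\<close>

definition swap_adj :: "'a set \<Rightarrow> 'a set \<Rightarrow> bool" where
  "swap_adj A B \<longleftrightarrow> (\<exists>I a b. a \<notin> I \<and> b \<notin> I \<and> a \<noteq> b \<and> A = insert a I \<and> B = insert b I)"

lemma swap_adjE:
  assumes "swap_adj A B"
  obtains x y where "\<forall>z. z \<in> A \<and> z \<notin> B \<longleftrightarrow> z = x" "\<forall>z. z \<in> B \<and> z \<notin> A \<longleftrightarrow> z = y"
proof -
  obtain I a b where "a \<notin> I" "b \<notin> I" "a \<noteq> b" "A = insert a I" "B = insert b I"
    using assms unfolding swap_adj_def by blast
  then show thesis by (intro that[of a b]) auto
qed

lemma swap_adj_diff_unique:
  assumes "swap_adj A B" "x \<in> A" "x \<notin> B" "y \<in> A" "y \<notin> B"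
  shows "x = y"
  using assms unfolding swap_adj_def by blast

text \<open>\<open>C\<close> arises from \<open>insert a I\<close> by giving up one element
  \<open>y\<close> and gaining one element \<open>x\<close>. Giving up \<open>a\<close> leaves
  \<open>I\<close> inside \<open>C\<close>; giving up an element of \<open>I\<close> already uses
  the one loss allowed against \<open>insert b I\<close>, so \<open>b\<close> must lie in
  \<open>C\<close>.\<close>

lemma swap_adj_triangle:
  assumes "a \<notin> I" "b \<notin> I" "a \<noteq> b"
    and A: "swap_adj C (insert a I)" and B: "swap_adj C (insert b I)"
  shows "(\<exists>c. c \<notin> insert a (insert b I) \<and> C = insert c I) \<or>
    (\<exists>d\<in>I. C = insert a (insert b I) - {d})"
proof -
  obtain x y where "\<forall>z. z \<in> C \<and> z \<notin> insert a I \<longleftrightarrow> z = x"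
    "\<forall>z. z \<in> insert a I \<and> z \<notin> C \<longleftrightarrow> z = y"
    using A by (rule swap_adjE)
  note x = this(1)[rule_format] and y = this(2)[rule_format]
  obtain x' y' where "\<forall>z. z \<in> C \<and> z \<notin> insert b I \<longleftrightarrow> z = x'"
    "\<forall>z. z \<in> insert b I \<and> z \<notin> C \<longleftrightarrow> z = y'"
    using B by (rule swap_adjE)
  note x' = this(1)[rule_format] and y' = this(2)[rule_format]
  have C: "z \<in> C \<longleftrightarrow> z = x \<or> z \<in> insert a I \<and> z \<noteq> y" for z
    using x[of z] y[of z] by argo
  show ?thesis
  proof (cases "y = a")
    case True
    then have "C = insert x I" using C x[of x] assms(1) by auto
    \<comment> \<open>Otherwise \<open>C\<close> would equal \<open>insert b I\<close> and have no
      element \<open>x'\<close> outside it.\<close>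
    moreover have "x \<noteq> b" using x'[of x'] C[of x'] True by auto
    ultimately show ?thesis using x[of x] by blast
  next
    case False
    then have "y \<in> I" "y \<notin> C" using y[of y] by auto
    then have "y' = y" using y'[of y] by simp
    then have "b \<in> C" using y'[of b] \<open>y \<in> I\<close> assms(2) by auto
    then have "x = b" using x[of b] assms(2,3) by simp
    then have "C = insert a (insert b I) - {y}"
      using C \<open>y \<in> I\<close> assms(2) by (intro set_eqI) auto
    then show ?thesis using \<open>y \<in> I\<close> by blast
  qed
qed

text \<open>Two distinct members fix \<open>I\<close> and \<open>U\<close>, and the other members
  are then all of one kind. Excluding the empty set matters when \<open>X\<close> has a single
  member, which must have an element to split off.\<close>

lemma swap_adj_clique_cases:
  assumes adj: "\<And>A B. A \<in> X \<Longrightarrow> B \<in> X \<Longrightarrow> A \<noteq> B \<Longrightarrow> swap_adj A B"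
    and nonempty: "{} \<notin> X"
  shows "(\<exists>I. \<forall>C\<in>X. \<exists>c. c \<notin> I \<and> C = insert c I) \<or> (\<forall>C\<in>X. \<exists>c\<in>\<Union>X. C = \<Union>X - {c})"
proof (cases "\<exists>A\<in>X. \<exists>B\<in>X. A \<noteq> B")
  case False
  show ?thesis
  proof (cases "X = {}")
    case False
    then obtain A where A: "A \<in> X" by blast
    then have "A \<noteq> {}" using nonempty by metis
    then obtain a where "a \<in> A" by blast
    have "\<exists>c. c \<notin> A - {a} \<and> C = insert c (A - {a})" if "C \<in> X" for C
    proof -
      have "C = A" using \<open>\<not> (\<exists>A\<in>X. \<exists>B\<in>X. A \<noteq> B)\<close> A that by blast
      then show ?thesis using \<open>a \<in> A\<close> by (intro exI[of _ a]) auto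
    qed
    then show ?thesis by (intro disjI1 exI[of _ "A - {a}"] ballI)
  qed simp
next
  case True
  then obtain A B where AB: "A \<in> X" "B \<in> X" "A \<noteq> B" by blast
  obtain I a b where I: "a \<notin> I" "b \<notin> I" "a \<noteq> b" "A = insert a I" "B = insert b I"
    using adj[OF AB] unfolding swap_adj_def by blast
  define U where "U = insert a (insert b I)"
  have split: "C = A \<or> C = B \<or> (\<exists>c. c \<notin> U \<and> C = insert c I) \<or> (\<exists>d\<in>I. C = U - {d})"
    if "C \<in> X" for C
    using swap_adj_triangle[OF I(1-3)] adj[OF that AB(1)] adj[OF that AB(2)] I(4,5)
    unfolding U_def by blast
  \<comment> \<open>Both \<open>a\<close> and \<open>b\<close> lie in \<open>U - {d}\<close> and
    outside \<open>insert c I\<close>, whereas adjacency allows only one such element.\<close>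
  have "\<not> (c \<notin> U \<and> d \<in> I \<and> insert c I \<in> X \<and> U - {d} \<in> X)" for c d
  proof
    assume *: "c \<notin> U \<and> d \<in> I \<and> insert c I \<in> X \<and> U - {d} \<in> X"
    then have "swap_adj (U - {d}) (insert c I)" by (intro adj) (auto simp: U_def)
    from swap_adj_diff_unique[OF this, of a b] show False
      using * I by (auto simp: U_def)
  qed
  then have "(\<forall>c. c \<notin> U \<longrightarrow> insert c I \<notin> X) \<or> (\<forall>d\<in>I. U - {d} \<notin> X)"
    by blast
  then consider "\<forall>C\<in>X. C = A \<or> C = B \<or> (\<exists>c. c \<notin> U \<and> C = insert c I)"
    | "\<forall>C\<in>X. C = A \<or> C = B \<or> (\<exists>d\<in>I. C = U - {d})"
  proof (elim disjE)
    assume *: "\<forall>c. c \<notin> U \<longrightarrow> insert c I \<notin> X"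
    have "\<forall>C\<in>X. C = A \<or> C = B \<or> (\<exists>d\<in>I. C = U - {d})"
      using split * by fast
    then show thesis by (rule that(2))
  next
    assume *: "\<forall>d\<in>I. U - {d} \<notin> X"
    have "\<forall>C\<in>X. C = A \<or> C = B \<or> (\<exists>c. c \<notin> U \<and> C = insert c I)"
      using split * by fast
    then show thesis by (rule that(1))
  qed
  then show ?thesis
  proof cases
    case 1
    then have "\<forall>C\<in>X. \<exists>c. c \<notin> I \<and> C = insert c I"
      using I unfolding U_def by blast
    then show ?thesis by blast
  next
    case 2
    \<comment> \<open>The two initial members fit this kind as well, with the labels exchanged:
      \<open>A\<close> is the set that misses \<open>b\<close>.\<close>
    have U: "A = U - {b}" "B = U - {a}" "a \<in> U" "b \<in> U" "I \<subseteq> U"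
      using I by (auto simp: U_def)
    have "\<exists>c\<in>U. C = U - {c}" if "C \<in> X" for C
      using 2[rule_format, OF that] U by (elim disjE) auto
    moreover have "\<Union>X = U"
    proof
      show "\<Union>X \<subseteq> U" using calculation by (intro Union_least) force
      show "U \<subseteq> \<Union>X" using AB(1,2) I(4,5) unfolding U_def by auto
    qed
    ultimately show ?thesis by simp
  qed
qed

section \<open>Arcs and cliques of the token graph\<close>

context pair_graph
begin

lemma arcs_irrefl: "(v, v) \<notin> parcs G"
  using no_loops' by blast

lemma arc_sym: "(u, v) \<in> parcs G \<Longrightarrow> (v, u) \<in> parcs G"
  using pair_sym_arcs unfolding symmetric_def with_proj_simps by (rule symD)

lemma token_arc_imp_swap_adj:
  assumes "(A, B) \<in> parcs (token_graph k G)"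
  shows "swap_adj A B"
proof -
  obtain a b where ab: "a \<in> A" "b \<in> B" "sym_diff A B = {a, b}" "(a, b) \<in> parcs G"
    using assms unfolding arcs_token_graph_iff by blast
  then have "a \<noteq> b" using arcs_irrefl by blast
  moreover have "a \<notin> B" "b \<notin> A" using ab(1-3) \<open>a \<noteq> b\<close> by blast+
  moreover from this have "A - B = {a}" "B - A = {b}" using ab(1-3) by auto
  then have "A = insert a (A \<inter> B)" "B = insert b (A \<inter> B)" by blast+
  moreover have "a \<notin> A \<inter> B" "b \<notin> A \<inter> B" using \<open>a \<notin> B\<close> \<open>b \<notin> A\<close> by simp_all
  ultimately show ?thesis
    unfolding swap_adj_def by (intro exI[of _ "A \<inter> B"] exI conjI)
qed

text \<open>The symmetric difference is \<open>{u, v}\<close>. Since \<open>v\<close> is not in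
  \<open>insert u S\<close>, the witnesses in the definition of an arc can only be \<open>u\<close>
  and \<open>v\<close> in this order.\<close>

lemma token_arc_insert_iff:
  assumes "u \<notin> S" "v \<notin> S" "u \<noteq> v"
    and "insert u S \<in> [pverts G]\<^bsup>k\<^esup>" "insert v S \<in> [pverts G]\<^bsup>k\<^esup>"
  shows "(insert u S, insert v S) \<in> parcs (token_graph k G) \<longleftrightarrow> (u, v) \<in> parcs G"
proof -
  have sd: "sym_diff (insert u S) (insert v S) = {u, v}" using assms(1-3) by blast
  have "a = u \<and> b = v"
    if "a \<in> insert u S" "b \<in> insert v S" "{u, v} = {a, b}" for a b
    using that assms(1-3) unfolding doubleton_eq_iff by blast
  then have "(\<exists>a\<in>insert u S. \<exists>b\<in>insert v S. {u, v} = {a, b} \<and> (a, b) \<in> parcs G)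
      \<longleftrightarrow> (u, v) \<in> parcs G"
    by (metis insertI1)
  then show ?thesis
    using assms(4,5) unfolding arcs_token_graph_iff sd by simp
qed

text \<open>Removing \<open>u\<close> from \<open>U\<close> amounts to inserting \<open>v\<close>
  into \<open>U - {u, v}\<close>. The roles of \<open>u\<close> and \<open>v\<close> are thus
  exchanged, and symmetry of the arcs restores the order.\<close>

lemma token_arc_remove_iff:
  assumes "u \<in> U" "v \<in> U" "u \<noteq> v"
    and "U - {u} \<in> [pverts G]\<^bsup>k\<^esup>" "U - {v} \<in> [pverts G]\<^bsup>k\<^esup>"
  shows "(U - {u}, U - {v}) \<in> parcs (token_graph k G) \<longleftrightarrow> (u, v) \<in> parcs G"
proof -
  have "U - {u} = insert v (U - {u, v})" "U - {v} = insert u (U - {u, v})"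
    using assms(1-3) by blast+
  then have "(U - {u}, U - {v}) \<in> parcs (token_graph k G) \<longleftrightarrow> (v, u) \<in> parcs G"
    using token_arc_insert_iff[of v "U - {u, v}" u k] assms(3-5) by auto
  then show ?thesis using arc_sym by blast
qed

text \<open>The map \<open>v\<close> to \<open>insert v S\<close> is injective on \<open>K\<close>
  and preserves and reflects arcs.\<close>

lemma is_clique_token_star_iff:
  assumes "K \<inter> S = {}" "(\<lambda>v. insert v S) ` K \<subseteq> [pverts G]\<^bsup>k\<^esup>"
  shows "is_clique (token_graph k G) ((\<lambda>v. insert v S) ` K) \<longleftrightarrow> is_clique G K"
proof -
  have "K \<subseteq> pverts G" using assms(2) unfolding nsets_def by blast
  moreover have "insert u S \<noteq> insert v S \<longleftrightarrow> u \<noteq> v" if "u \<in> K" "v \<in> K" for u v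
    using that assms(1) by blast
  moreover have "(insert u S, insert v S) \<in> parcs (token_graph k G) \<longleftrightarrow> (u, v) \<in> parcs G"
    if "u \<in> K" "v \<in> K" "u \<noteq> v" for u v
    using that assms by (intro token_arc_insert_iff) blast+
  ultimately show ?thesis
    using assms(2) unfolding is_clique_def by simp
qed

text \<open>As for stars, with complements in \<open>U\<close>. That \<open>K\<close> consists of
  vertices comes from \<open>U \<subseteq> pverts G\<close>, since a set \<open>U - {v}\<close>
  alone says nothing about \<open>v\<close>.\<close>

lemma is_clique_token_costar_iff:
  assumes "K \<subseteq> U" "U \<subseteq> pverts G" "(\<lambda>v. U - {v}) ` K \<subseteq> [pverts G]\<^bsup>k\<^esup>"
  shows "is_clique (token_graph k G) ((\<lambda>v. U - {v}) ` K) \<longleftrightarrow> is_clique G K"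
proof -
  have "K \<subseteq> pverts G" using assms(1,2) by blast
  moreover have "U - {u} \<noteq> U - {v} \<longleftrightarrow> u \<noteq> v" if "u \<in> K" "v \<in> K" for u v
    using that assms(1) by blast
  moreover have "(U - {u}, U - {v}) \<in> parcs (token_graph k G) \<longleftrightarrow> (u, v) \<in> parcs G"
    if "u \<in> K" "v \<in> K" "u \<noteq> v" for u v
    using that assms by (intro token_arc_remove_iff) blast+
  ultimately show ?thesis
    using assms(3) unfolding is_clique_def by simp
qed

lemma token_clique_cases:
  assumes X: "is_clique (token_graph k G) X" and "k \<ge> 1" and n: "card (pverts G) \<ge> k + 1"
  shows "\<exists>K S. is_clique G K \<and> S \<subseteq> pverts G \<and> K \<inter> S = {} \<and>
      ((X = (\<lambda>v. insert v S) ` K \<and> card S = k - 1) \<or>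
       (X = (\<lambda>v. (S \<union> K) - {v}) ` K \<and> card S + card K = k + 1))"
proof -
  have sub: "X \<subseteq> [pverts G]\<^bsup>k\<^esup>" using X unfolding is_clique_def by simp
  have "swap_adj A B" if "A \<in> X" "B \<in> X" "A \<noteq> B" for A B
    using X that unfolding is_clique_def by (intro token_arc_imp_swap_adj[of A B k]) blast
  moreover have "{} \<notin> X" using sub \<open>k \<ge> 1\<close> unfolding nsets_def by auto
  ultimately have "(\<exists>I. \<forall>C\<in>X. \<exists>c. c \<notin> I \<and> C = insert c I) \<or> (\<forall>C\<in>X. \<exists>c\<in>\<Union>X. C = \<Union>X - {c})"
    by (rule swap_adj_clique_cases)
  \<comment> \<open>The empty clique satisfies both alternatives vacuously and determines no sizes,
    so it is treated apart.\<close>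
  then consider "X = {}"
    | I where "X \<noteq> {}" "\<forall>C\<in>X. \<exists>c. c \<notin> I \<and> C = insert c I"
    | "X \<noteq> {}" "\<forall>C\<in>X. \<exists>c\<in>\<Union>X. C = \<Union>X - {c}" by meson
  then show ?thesis
  proof cases
    case 1
    \<comment> \<open>The empty clique is the star with \<open>K\<close> empty; the bound on the
      number of vertices supplies an \<open>S\<close> of the right size.\<close>
    obtain S where "S \<subseteq> pverts G" "card S = k - 1"
      by (rule obtain_subset_with_card_n[of "k - 1" "pverts G"]) (use n in simp)
    then show ?thesis
      using 1 by (intro exI[of _ "{}"] exI[of _ S]) (auto simp: is_clique_def)
  next
    case (2 I)
    define K where "K = {v. v \<notin> I \<and> insert v I \<in> X}"
    have XK: "X = (\<lambda>v. insert v I) ` K"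
    proof (intro set_eqI iffI)
      fix C assume C: "C \<in> X"
      then obtain c where "c \<notin> I" "C = insert c I" using 2(2) by meson
      then show "C \<in> (\<lambda>v. insert v I) ` K" using C by (simp add: K_def)
    qed (auto simp: K_def)
    have KI: "K \<inter> I = {}" unfolding K_def by blast
    have cl: "is_clique G K"
      using is_clique_token_star_iff[OF KI, of k] sub X unfolding XK[symmetric] by blast
    \<comment> \<open>A single member of \<open>X\<close> determines the size of \<open>I\<close>
      and places it among the vertices.\<close>
    obtain v where v: "v \<in> K" using 2(1) XK by blast
    then have "insert v I \<in> [pverts G]\<^bsup>k\<^esup>" "v \<notin> I" using sub unfolding K_def by blast+
    then have "I \<subseteq> pverts G" "card I = k - 1" unfolding nsets_def by auto
    then show ?thesis using cl KI XK by blast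
  next
    case 3
    define U where "U = \<Union>X"
    have U: "\<forall>C\<in>X. \<exists>c\<in>U. C = U - {c}" using 3(2) unfolding U_def .
    have UG: "U \<subseteq> pverts G" using sub unfolding U_def nsets_def by blast
    define K where "K = {v \<in> U. U - {v} \<in> X}"
    have XK: "X = (\<lambda>v. U - {v}) ` K"
    proof (intro set_eqI iffI)
      fix C assume C: "C \<in> X"
      then obtain c where "c \<in> U" "C = U - {c}" using U by meson
      then show "C \<in> (\<lambda>v. U - {v}) ` K" using C by (simp add: K_def)
    qed (auto simp: K_def)
    have KU: "K \<subseteq> U" unfolding K_def by blast
    obtain A where A: "A \<in> X" using 3(1) by blast
    then obtain v where v: "v \<in> U" "A = U - {v}" using U by meson
    then have "U - {v} \<in> [pverts G]\<^bsup>k\<^esup>" using A sub by blast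
    then have fin: "finite U" and cU: "card U = k + 1"
      using v(1) \<open>k \<ge> 1\<close> by (auto simp: nsets_def card_Diff_singleton_if)
    have cl: "is_clique G K"
      using is_clique_token_costar_iff[OF KU UG, of k] sub X unfolding XK[symmetric] by blast
    \<comment> \<open>The set \<open>S\<close> of the second form is \<open>U - K\<close>, so that
      \<open>S \<union> K\<close> is all of \<open>U\<close>.\<close>
    have "card (U - K) + card K = k + 1"
      using KU fin cU card_mono[OF fin KU] by (simp add: card_Diff_subset finite_subset)
    moreover have "(U - K) \<union> K = U" using KU by blast
    moreover have "U - K \<subseteq> pverts G" "K \<inter> (U - K) = {}" using UG by blast+
    ultimately show ?thesis using cl XK
      by (intro exI[of _ K] exI[of _ "U - K"] conjI disjI2) simp_all
  qed
qed

end

theorem theorem8: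
  fixes G :: "'a pair_pre_digraph" and n k :: nat and X :: "'a set set"
  assumes "pair_graph G"
    and "card (pverts G) = n"
    and "k \<ge> 1"
    and "n \<ge> k + 1"
    and "X \<subseteq> pverts (token_graph k G)"
  shows "is_clique (token_graph k G) X \<longleftrightarrow>
    (\<exists>K S. is_clique G K \<and> S \<subseteq> pverts G \<and> K \<inter> S = {} \<and>
      ((X = {S \<union> {v} | v. v \<in> K} \<and> card S = k - 1) \<or>
       (X = {(S \<union> K) - {v} | v. v \<in> K} \<and> card S + card K = k + 1)))"
proof -
  interpret pair_graph G by fact
  have star: "{S \<union> {v} | v. v \<in> K} = (\<lambda>v. insert v S) ` K" for S K :: "'a set" by auto
  have costar: "{(S \<union> K) - {v} | v. v \<in> K} = (\<lambda>v. (S \<union> K) - {v}) ` K" for S K :: "'a set"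
    by auto
  have sub: "X \<subseteq> [pverts G]\<^bsup>k\<^esup>" using assms(5) by simp
  show ?thesis
    unfolding star costar
  proof
    assume "is_clique (token_graph k G) X"
    then show "\<exists>K S. is_clique G K \<and> S \<subseteq> pverts G \<and> K \<inter> S = {} \<and>
      ((X = (\<lambda>v. insert v S) ` K \<and> card S = k - 1) \<or>
       (X = (\<lambda>v. (S \<union> K) - {v}) ` K \<and> card S + card K = k + 1))"
      by (rule token_clique_cases) (use assms in auto)
  next
    assume "\<exists>K S. is_clique G K \<and> S \<subseteq> pverts G \<and> K \<inter> S = {} \<and>
      ((X = (\<lambda>v. insert v S) ` K \<and> card S = k - 1) \<or>
       (X = (\<lambda>v. (S \<union> K) - {v}) ` K \<and> card S + card K = k + 1))"
    then obtain K S where K: "is_clique G K" and S: "S \<subseteq> pverts G" "K \<inter> S = {}"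
      and "X = (\<lambda>v. insert v S) ` K \<or> X = (\<lambda>v. (S \<union> K) - {v}) ` K"
      by blast
    moreover have "S \<union> K \<subseteq> pverts G" using K S unfolding is_clique_def by blast
    \<comment> \<open>By \<open>sub\<close> all members of \<open>X\<close> are
      \<open>k\<close>-subsets of the vertex set, as both equivalences require; the second is
      applied with \<open>U\<close> equal to \<open>S \<union> K\<close>.\<close>
    ultimately show "is_clique (token_graph k G) X"
      using is_clique_token_star_iff[of K S k] is_clique_token_costar_iff[of K "S \<union> K" k] sub
      by blast
  qed
qed

end
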